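(* Let $n\ge3$, let $u$ be any integer, and let $k\ge1$, $s\ge1$ and $a_1,\dots,a_s,b_1,\dots,b_{s-1}\ge1$ be integers. Then, as projective transformations (that is, in $\mathrm{PSL}_2(\mathbb R)$), $$A^uC\,(A^kC)^{a_s}(A^{k+1}C)^{b_{s-1}}(A^kC)^{a_{s-1}}\cdots(A^{k+1}C)^{b_1}(A^kC)^{a_1}$$ $$=A^{u-1}CA^{-1}C\;X^{a_s}\,Y^{b_{s-1}}\,X^{a_{s-1}}\cdots Y^{b_1}\,X^{a_1-1}\,(A^{-1}C)^{n-3}W^kA^{-1},$$ where $X=(A^{-1}C)^{n-3}W^{k-1}A^{-2}C$ and $Y=(A^{-1}C)^{n-3}W^kA^{-2}C$.
   Context: For $n\ge3$ put $t=1+2\cos(\pi/n)$, $A=\begin{pmatrix}1&t\\0&1\end{pmatrix}$, $C=\begin{pmatrix}-1&1\\-1&0\end{pmatrix}$ and $W=A^{-2}C(A^{-1}C)^{n-3}A^{-2}C(A^{-1}C)^{n-2}$. All matrices are considered projectively, i.e. up to sign. *)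

theory Defs
  imports "HOL-Analysis.Analysis" "HOL-Algebra.Coset"
begin

definition SL2 :: "(real ^ 2 ^ 2) monoid" where
  "SL2 = \<lparr>carrier = {M. det M = 1}, monoid.mult = (**), one = mat 1\<rparr>"

definition PSL2 :: "(real ^ 2 ^ 2) set monoid" where
  "PSL2 = SL2 Mod {mat 1, - mat 1}"

definition proj :: "real ^ 2 ^ 2 \<Rightarrow> (real ^ 2 ^ 2) set" where
  "proj M = {mat 1, - mat 1} #>\<^bsub>SL2\<^esub> M"

definition elemA :: "nat \<Rightarrow> (real ^ 2 ^ 2) set" where
  "elemA n = proj (vector [vector [1, 1 + 2 * cos (pi / real n)], vector [0, 1]])"

definition elemC :: "(real ^ 2 ^ 2) set" where
  "elemC = proj (vector [vector [-1, 1], vector [-1, 0]])"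

text \<open>The natural-number subtractions below are exact for \<open>n \<ge> 3\<close>; negative powers
  are integer powers in the group.\<close>

definition elemW :: "nat \<Rightarrow> (real ^ 2 ^ 2) set" where
  "elemW n =
    (let A = elemA n; C = elemC;
         U = A [^]\<^bsub>PSL2\<^esub> (-1::int) \<otimes>\<^bsub>PSL2\<^esub> C;
         V = A [^]\<^bsub>PSL2\<^esub> (-2::int) \<otimes>\<^bsub>PSL2\<^esub> C
     in V \<otimes>\<^bsub>PSL2\<^esub> U [^]\<^bsub>PSL2\<^esub> (n - 3) \<otimes>\<^bsub>PSL2\<^esub> V \<otimes>\<^bsub>PSL2\<^esub> U [^]\<^bsub>PSL2\<^esub> (n - 2))"

text \<open>\<open>blocks P Q a b m\<close> is the ordered product
  \<open>(P^a(m+1) Q^b(m)) (P^a(m) Q^b(m-1)) ... (P^a(2) Q^b(1))\<close>, with indices decreasing from left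
  to right; it is empty for \<open>m = 0\<close>.\<close>

primrec blocks ::
  "(real ^ 2 ^ 2) set \<Rightarrow> (real ^ 2 ^ 2) set \<Rightarrow> (nat \<Rightarrow> nat) \<Rightarrow> (nat \<Rightarrow> nat) \<Rightarrow> nat \<Rightarrow> (real ^ 2 ^ 2) set" where
  "blocks P Q a b 0 = \<one>\<^bsub>PSL2\<^esub>"
| "blocks P Q a b (Suc m) =
     P [^]\<^bsub>PSL2\<^esub> a (Suc (Suc m)) \<otimes>\<^bsub>PSL2\<^esub> Q [^]\<^bsub>PSL2\<^esub> b (Suc m) \<otimes>\<^bsub>PSL2\<^esub> blocks P Q a b m"

lemma group_SL2: "group SL2"
proof (rule groupI)
  fix M assume M: "M \<in> carrier SL2"
  then have "invertible M"
    by (simp add: SL2_def invertible_det_nz)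
  then obtain N where N: "N ** M = mat 1"
    by (auto simp: invertible_def)
  have "det N * det M = 1"
    using N by (metis det_mul det_I)
  with M have "det N = 1"
    by (simp add: SL2_def)
  with N show "\<exists>N\<in>carrier SL2. N \<otimes>\<^bsub>SL2\<^esub> M = \<one>\<^bsub>SL2\<^esub>"
    by (auto simp: SL2_def)
qed (auto simp: SL2_def det_mul matrix_mul_assoc)

lemma normal_sign: "{mat 1, - mat 1} \<lhd> SL2"
proof -
  interpret group SL2 by (rule group_SL2)
  have neg_l: "(- M) ** N = - (M ** N)" and neg_r: "M ** (- N) = - (M ** N)"
    for M N :: "real ^ 2 ^ 2"
    by (simp_all add: matrix_matrix_mult_def vec_eq_iff sum_negf)
  have det1: "det (- mat 1 :: real ^ 2 ^ 2) = 1"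
    by (simp add: det_2 mat_def)
  have inv1: "inv\<^bsub>SL2\<^esub> (- mat 1) = - mat 1"
    by (rule inv_equality) (simp_all add: SL2_def neg_l det1)
  have inv2: "inv\<^bsub>SL2\<^esub> (mat 1) = mat 1"
    by (rule inv_equality) (simp_all add: SL2_def)
  have "subgroup {mat 1, - mat 1} SL2"
    by (unfold_locales; insert inv1 inv2) (auto simp: SL2_def neg_l det1)
  then show ?thesis
  proof (rule normalI, intro ballI)
    fix M assume "M \<in> carrier SL2"
    show "{mat 1, - mat 1} #>\<^bsub>SL2\<^esub> M = M <#\<^bsub>SL2\<^esub> {mat 1, - mat 1}"
      by (auto simp: r_coset_def l_coset_def SL2_def neg_l neg_r)
  qed
qed

lemma group_PSL2: "group PSL2"
  unfolding PSL2_def by (rule normal.factorgroup_is_group[OF normal_sign])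

lemma proj_eq: "proj M = {M, - M}"
  by (auto simp: proj_def r_coset_def SL2_def matrix_matrix_mult_def mat_def vec_eq_iff sum_negf
      if_distrib[of "\<lambda>x. x * _"] sum.delta cong: if_cong)

lemma proj_eq_iff: "proj M = proj N \<longleftrightarrow> M = N \<or> M = - N"
  by (auto simp: proj_eq doubleton_eq_iff)

lemma proj_carrier: "det M = 1 \<Longrightarrow> proj M \<in> carrier PSL2"
  by (auto simp: proj_def PSL2_def FactGroup_def RCOSETS_def SL2_def)

lemma proj_mult:
  assumes "det M = 1" "det N = 1"
  shows "proj M \<otimes>\<^bsub>PSL2\<^esub> proj N = proj (M ** N)"
  using normal.rcos_sum[OF normal_sign, of M N] assms
  by (simp add: proj_def PSL2_def FactGroup_def SL2_def)

lemma elemA_carrier: "elemA n \<in> carrier PSL2"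
  unfolding elemA_def by (rule proj_carrier) (simp add: det_2)

lemma elemC_carrier: "elemC \<in> carrier PSL2"
  unfolding elemC_def by (rule proj_carrier) (simp add: det_2)

end

theory Submission
  imports Defs
begin

text \<open>
  Put \<open>U = A\<^sup>-\<^sup>1 C\<close>. The only facts about the matrices that enter are the projective relations
  \<open>C\<^sup>3 = 1\<close> and \<open>U\<^sup>n = 1\<close>: the matrix \<open>C\<close> has determinant \<open>1\<close> and trace \<open>-1\<close>, and \<open>U\<close> has
  determinant \<open>1\<close> and trace \<open>2 cos (\<pi>/n)\<close>, hence eigenvalues \<open>e\<^sup>\<plusminus>\<^sup>i\<^sup>\<pi>\<^sup>/\<^sup>n\<close>. The rest is a computation in an arbitrary group with such elements, best
  written in the generators \<open>C\<close> and \<open>U\<close>, where \<open>A = C U\<^sup>-\<^sup>1\<close>.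

  The relations give \<open>U\<^sup>n\<^sup>-\<^sup>3 = U\<^sup>-\<^sup>3\<close> and \<open>U\<^sup>n\<^sup>-\<^sup>2 = U\<^sup>-\<^sup>2\<close>, and \<open>W\<close> collapses to the conjugate
  \<open>(U C) A (U C)\<^sup>-\<^sup>1\<close>. So powers of \<open>W\<close> are conjugates of powers of \<open>A\<close>, and one finds that the
  single element \<open>g = C\<^sup>-\<^sup>1 U\<^sup>2\<close> conjugates each syllable on the left to one on the right:
  \<open>(A\<^sup>j\<^sup>+\<^sup>1 C) g = g (U\<^sup>n\<^sup>-\<^sup>3 W\<^sup>j A\<^sup>-\<^sup>2 C)\<close> for every \<open>j \<ge> 0\<close> (\<open>syllable_intertwine\<close>). For \<open>j = k - 1\<close> and \<open>j = k\<close>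
  this turns the whole block product in \<open>A\<^sup>k C\<close> and \<open>A\<^sup>k\<^sup>+\<^sup>1 C\<close> into the one in \<open>X\<close> and \<open>Y\<close>. At the right
  end the last syllable is not conjugated but supplies the \<open>g\<close> that is moved to the left,
  \<open>A\<^sup>k C = g (U\<^sup>n\<^sup>-\<^sup>3 W\<^sup>k A\<^sup>-\<^sup>1)\<close> (\<open>last_syllable\<close>), which is why \<open>X\<close> occurs there with exponent
  \<open>a\<^sub>1 - 1\<close>; at the left end \<open>A\<^sup>u C g = A\<^sup>u\<^sup>-\<^sup>1 C U\<close> (\<open>first_syllable\<close>).
\<close>

section \<open>Words in a group with \<open>C\<^sup>3 = (A\<^sup>-\<^sup>1 C)\<^sup>n = 1\<close>\<close>

context group
begin

lemma pow_intertwine: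
  assumes "x \<in> carrier G" "y \<in> carrier G" "g \<in> carrier G" and "y \<otimes> g = g \<otimes> x"
  shows "y [^] (m::nat) \<otimes> g = g \<otimes> x [^] m"
proof (induction m)
  case 0
  then show ?case using assms by simp
next
  case (Suc m)
  have "y [^] Suc m \<otimes> g = y [^] m \<otimes> g \<otimes> x"
    using assms by (simp add: m_assoc)
  then show ?case
    using assms Suc by (simp add: m_assoc)
qed

lemma cancel_inv_left:
  assumes "x \<in> carrier G" "y \<in> carrier G"
  shows "x \<otimes> (inv x \<otimes> y) = y" "inv x \<otimes> (x \<otimes> y) = y"
  using assms by (simp_all flip: m_assoc)

lemma pow_diff_of_order:
  assumes "x \<in> carrier G" "x [^] (n::nat) = \<one>" "j \<le> n"
  shows "x [^] (n - j) = inv (x [^] j)"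
  using assms by (intro inv_equality[symmetric]) (simp_all add: nat_pow_mult)

end

text \<open>
  These are the relations of the triangle group of type \<open>(3, n, \<infinity>)\<close>; in the application \<open>A\<close> is the
  parabolic element.
\<close>

locale triangle_group = group +
  fixes A C U V W :: 'a and n :: nat
  assumes A [simp]: "A \<in> carrier G" and C [simp]: "C \<in> carrier G"
    and U_def: "U = inv A \<otimes> C"
    and V_def: "V = inv A \<otimes> inv A \<otimes> C"
    and W_def: "W = V \<otimes> U [^] (n - 3) \<otimes> V \<otimes> U [^] (n - 2)"
    and C_cubed: "C \<otimes> C \<otimes> C = \<one>"
    and U_order: "U [^] n = \<one>" and n: "n \<ge> 3"
begin

lemma U_closed [simp]: "U \<in> carrier G"
  by (simp add: U_def)

lemma A_eq: "A = C \<otimes> inv U"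
  by (simp add: U_def inv_mult_group cancel_inv_left)

lemma C_square: "C \<otimes> C = inv C"
  using C_cubed by (intro inv_equality[symmetric]) auto

lemma C_square_left: "x \<in> carrier G \<Longrightarrow> C \<otimes> (C \<otimes> x) = inv C \<otimes> x"
  by (simp add: C_square flip: m_assoc)

lemma inv_C_square: "inv C \<otimes> inv C = C"
  using C_square by (metis C inv_inv inv_mult_group)

lemma inv_C_square_left: "x \<in> carrier G \<Longrightarrow> inv C \<otimes> (inv C \<otimes> x) = C \<otimes> x"
  by (simp add: inv_C_square flip: m_assoc)

text \<open>
  Rewriting to normal form in the free product of the order-three group generated by \<open>C\<close> and the
  infinite cyclic group generated by \<open>U\<close>. The order of \<open>U\<close> is not part of the rewriting; it enters
  only through the two lemmas that follow.
\<close>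

lemmas word_simps = m_assoc inv_mult_group cancel_inv_left
  C_square C_square_left inv_C_square inv_C_square_left

lemma U_pow_minus_3: "U [^] (n - 3) = inv U \<otimes> inv U \<otimes> inv U"
  using n by (simp add: pow_diff_of_order U_order numeral_3_eq_3 word_simps)

lemma U_pow_minus_2: "U [^] (n - 2) = inv U \<otimes> inv U"
  using n by (simp add: pow_diff_of_order U_order numeral_2_eq_2 word_simps)

lemma V_eq: "V = U \<otimes> inv C \<otimes> U"
  by (simp add: V_def A_eq word_simps)

lemma W_eq: "W = U \<otimes> inv C \<otimes> inv U \<otimes> inv C \<otimes> inv U"
  by (simp add: W_def U_pow_minus_2 U_pow_minus_3 V_eq word_simps)

lemma W_closed [simp]: "W \<in> carrier G"
  by (simp add: W_eq)

text \<open>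
  The word \<open>U C\<^sup>-\<^sup>1 U\<^sup>-\<^sup>1 C\<^sup>-\<^sup>1 U\<^sup>-\<^sup>1\<close> left of \<open>W\<close> is \<open>(U C) (C U\<^sup>-\<^sup>1) (U C)\<^sup>-\<^sup>1\<close>, because
  \<open>C\<^sup>-\<^sup>1 = C C\<close>, and \<open>C U\<^sup>-\<^sup>1 = A\<close>.
\<close>

lemma W_conj_A: "W \<otimes> (U \<otimes> C) = (U \<otimes> C) \<otimes> A"
  by (simp add: W_eq A_eq word_simps)

lemma W_pow: "W [^] (j::nat) = U \<otimes> C \<otimes> A [^] j \<otimes> inv C \<otimes> inv U"
proof -
  have "W [^] j \<otimes> (U \<otimes> C) = (U \<otimes> C) \<otimes> A [^] j"
    by (rule pow_intertwine) (simp_all add: W_conj_A)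
  then have "W [^] j = (U \<otimes> C) \<otimes> A [^] j \<otimes> inv (U \<otimes> C)"
    by (metis A C U_closed W_closed inv_solve_right m_closed nat_pow_closed)
  then show ?thesis
    by (simp add: word_simps)
qed

text \<open>
  Both sides reduce to \<open>A\<^sup>j C U\<close>: on the left \<open>A\<^sup>j\<^sup>+\<^sup>1 = A\<^sup>j C U\<^sup>-\<^sup>1\<close> and \<open>C\<close> cancels
  against \<open>C\<^sup>-\<^sup>1\<close>, on the right \<open>U\<^sup>n\<^sup>-\<^sup>3 W\<^sup>j V = U\<^sup>-\<^sup>2 C A\<^sup>j C U\<close>.
\<close>

lemma syllable_intertwine:
  "(A [^] Suc j \<otimes> C) \<otimes> (inv C \<otimes> U \<otimes> U)
    = (inv C \<otimes> U \<otimes> U) \<otimes> (U [^] (n - 3) \<otimes> W [^] j \<otimes> V)"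
proof -
  \<comment> \<open>Only one factor \<open>A\<close> is rewritten; the power \<open>A\<^sup>j\<close> stays an opaque letter of the word.\<close>
  have A_Suc: "A [^] Suc j = A [^] j \<otimes> (C \<otimes> inv U)"
    using A_eq by simp
  show ?thesis
    unfolding A_Suc by (simp add: W_pow U_pow_minus_3 V_eq word_simps)
qed

text \<open>
  Here \<open>U\<^sup>n\<^sup>-\<^sup>3 W\<^sup>j A\<^sup>-\<^sup>1 = U\<^sup>-\<^sup>2 C A\<^sup>j C\<close>, so that the prefix \<open>U\<^sup>-\<^sup>2 C\<close> is exactly what the
  conjugating element cancels.
\<close>

lemma last_syllable:
  fixes j :: nat
  shows "(inv C \<otimes> U \<otimes> U) \<otimes> (U [^] (n - 3) \<otimes> W [^] j \<otimes> inv A) = A [^] j \<otimes> C"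
proof -
  have "inv A = U \<otimes> inv C"
    by (subst A_eq) (simp add: word_simps)
  then show ?thesis
    by (simp add: W_pow U_pow_minus_3 word_simps)
qed

lemma first_syllable:
  "A [^] (u::int) \<otimes> C \<otimes> (inv C \<otimes> U \<otimes> U) = A [^] (u - 1) \<otimes> C \<otimes> U"
proof -
  have "A [^] u = A [^] (u - 1) \<otimes> A"
    using int_pow_mult[of A "u - 1" 1] by simp
  also have "\<dots> = A [^] (u - 1) \<otimes> (C \<otimes> inv U)"
    using A_eq by simp
  finally have Au: "A [^] u = A [^] (u - 1) \<otimes> (C \<otimes> inv U)" .
  show ?thesis
    unfolding Au by (simp add: word_simps)
qed

end

section \<open>Alternating block products\<close>

lemma blocks_closed:
  assumes "P \<in> carrier PSL2" "Q \<in> carrier PSL2"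
  shows "blocks P Q a b m \<in> carrier PSL2"
proof -
  interpret group PSL2 by (rule group_PSL2)
  show ?thesis by (induction m) (simp_all add: assms)
qed

lemma blocks_intertwine:
  assumes "P \<in> carrier PSL2" "Q \<in> carrier PSL2" "X \<in> carrier PSL2" "Y \<in> carrier PSL2"
    and "g \<in> carrier PSL2"
    and "P \<otimes>\<^bsub>PSL2\<^esub> g = g \<otimes>\<^bsub>PSL2\<^esub> X" "Q \<otimes>\<^bsub>PSL2\<^esub> g = g \<otimes>\<^bsub>PSL2\<^esub> Y"
  shows "blocks P Q a b m \<otimes>\<^bsub>PSL2\<^esub> g = g \<otimes>\<^bsub>PSL2\<^esub> blocks X Y a b m"
proof -
  interpret group PSL2 by (rule group_PSL2)
  note closed = assms(1-5) blocks_closed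
  show ?thesis
  proof (induction m)
    case 0
    then show ?case using closed by simp
  next
    case (Suc m)
    let ?p = "a (Suc (Suc m))" and ?q = "b (Suc m)"
    have "blocks P Q a b (Suc m) \<otimes>\<^bsub>PSL2\<^esub> g
        = P [^]\<^bsub>PSL2\<^esub> ?p \<otimes>\<^bsub>PSL2\<^esub> (Q [^]\<^bsub>PSL2\<^esub> ?q \<otimes>\<^bsub>PSL2\<^esub> g) \<otimes>\<^bsub>PSL2\<^esub> blocks X Y a b m"
      using closed Suc by (simp add: m_assoc)
    also have "Q [^]\<^bsub>PSL2\<^esub> ?q \<otimes>\<^bsub>PSL2\<^esub> g = g \<otimes>\<^bsub>PSL2\<^esub> Y [^]\<^bsub>PSL2\<^esub> ?q"
      using assms by (intro pow_intertwine)
    also have "P [^]\<^bsub>PSL2\<^esub> ?p \<otimes>\<^bsub>PSL2\<^esub> (g \<otimes>\<^bsub>PSL2\<^esub> Y [^]\<^bsub>PSL2\<^esub> ?q)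
        = (P [^]\<^bsub>PSL2\<^esub> ?p \<otimes>\<^bsub>PSL2\<^esub> g) \<otimes>\<^bsub>PSL2\<^esub> Y [^]\<^bsub>PSL2\<^esub> ?q"
      using closed by (simp add: m_assoc)
    also have "P [^]\<^bsub>PSL2\<^esub> ?p \<otimes>\<^bsub>PSL2\<^esub> g = g \<otimes>\<^bsub>PSL2\<^esub> X [^]\<^bsub>PSL2\<^esub> ?p"
      using assms by (intro pow_intertwine)
    finally show ?case
      using closed by (simp add: m_assoc)
  qed
qed

section \<open>The relations between the matrices\<close>

lemma one_PSL2: "\<one>\<^bsub>PSL2\<^esub> = proj (mat 1)"
  by (auto simp: PSL2_def FactGroup_def proj_eq)

lemma elemC_cubed: "elemC \<otimes>\<^bsub>PSL2\<^esub> elemC \<otimes>\<^bsub>PSL2\<^esub> elemC = \<one>\<^bsub>PSL2\<^esub>"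
proof -
  let ?C = "vector [vector [-1, 1], vector [-1, 0]] :: real ^ 2 ^ 2"
  have det: "det ?C = 1" by (simp add: det_2)
  have "?C ** ?C ** ?C = mat 1"
    by (simp add: matrix_matrix_mult_def mat_def vec_eq_iff sum_2 forall_2)
  then show ?thesis
    by (simp add: elemC_def proj_mult det det_mul one_PSL2)
qed

text \<open>
  The closed form of the \<open>m\<close>-th power of the matrix with rows \<open>(2 cos \<theta>, 1)\<close> and \<open>(-1, 0)\<close>. Its
  entries are, up to sign, values at \<open>cos \<theta>\<close> of Chebyshev polynomials of the second kind. The lower
  right entry is written with \<open>m \<theta> - \<theta>\<close>, and not with the angle \<open>(m - 1) \<theta>\<close> for a natural number
  \<open>m - 1\<close>, to be correct also for \<open>m = 0\<close>.
\<close>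

definition chebyshev_mat :: "real \<Rightarrow> nat \<Rightarrow> real ^ 2 ^ 2" where
  "chebyshev_mat \<theta> m = vector
     [vector [sin (real m * \<theta> + \<theta>) / sin \<theta>, sin (real m * \<theta>) / sin \<theta>],
      vector [- sin (real m * \<theta>) / sin \<theta>, - sin (real m * \<theta> - \<theta>) / sin \<theta>]]"

lemma chebyshev_mat_1:
  assumes "sin \<theta> \<noteq> 0"
  shows "chebyshev_mat \<theta> 1 = vector [vector [2 * cos \<theta>, 1], vector [-1, 0]]"
  using assms sin_double[of \<theta>] by (simp add: chebyshev_mat_def)

text \<open>
  The three-term recurrence \<open>2 cos \<theta> sin x - sin (x - \<theta>) = sin (x + \<theta>)\<close>, once for each entry of
  the first column.
\<close>

lemma chebyshev_mat_Suc:
  assumes "sin \<theta> \<noteq> 0"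
  shows "chebyshev_mat \<theta> m ** chebyshev_mat \<theta> 1 = chebyshev_mat \<theta> (Suc m)"
proof -
  let ?S = "\<lambda>x. sin x / sin \<theta>"
  have rec: "?S x * (2 * cos \<theta>) - ?S (x - \<theta>) = ?S (x + \<theta>)" for x
    by (simp add: sin_add sin_diff add_divide_distrib diff_divide_distrib)
  have Suc_eq: "real (Suc m) * \<theta> = real m * \<theta> + \<theta>"
    by (simp add: algebra_simps)
  show ?thesis
    using rec[of "real m * \<theta>"] rec[of "real m * \<theta> + \<theta>"]
    unfolding chebyshev_mat_1[OF assms]
    unfolding chebyshev_mat_def Suc_eq
    by (simp add: matrix_matrix_mult_def vec_eq_iff sum_2 forall_2)
qed

lemma chebyshev_mat_0:
  assumes "sin \<theta> \<noteq> 0"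
  shows "chebyshev_mat \<theta> 0 = mat 1"
  using assms by (simp add: chebyshev_mat_def mat_def vec_eq_iff forall_2)

lemma det_chebyshev_mat:
  assumes "sin \<theta> \<noteq> 0"
  shows "det (chebyshev_mat \<theta> m) = 1"
proof (induction m)
  case 0
  then show ?case by (simp add: chebyshev_mat_0[OF assms])
next
  case (Suc m)
  have "det (chebyshev_mat \<theta> 1) = 1"
    unfolding chebyshev_mat_1[OF assms] by (simp add: det_2)
  with Suc show ?case
    by (metis assms chebyshev_mat_Suc det_mul mult_1)
qed

lemma proj_chebyshev_pow:
  assumes "sin \<theta> \<noteq> 0"
  shows "proj (chebyshev_mat \<theta> 1) [^]\<^bsub>PSL2\<^esub> m = proj (chebyshev_mat \<theta> m)"
proof -
  interpret group PSL2 by (rule group_PSL2)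
  show ?thesis
  proof (induction m)
    case 0
    show ?case by (simp add: chebyshev_mat_0[OF assms] one_PSL2)
  next
    case (Suc m)
    then show ?case
      by (simp add: proj_mult det_chebyshev_mat[OF assms] chebyshev_mat_Suc[OF assms]
          del: One_nat_def)
  qed
qed

text \<open>
  The entry \<open>1 + 2 cos (\<pi>/n)\<close> of \<open>A\<close> is chosen so that \<open>A\<^sup>-\<^sup>1 C\<close> has trace \<open>2 cos (\<pi>/n)\<close>.
\<close>

lemma inv_elemA_mult_elemC:
  assumes "sin (pi / real n) \<noteq> 0"
  shows "inv\<^bsub>PSL2\<^esub> (elemA n) \<otimes>\<^bsub>PSL2\<^esub> elemC = proj (chebyshev_mat (pi / real n) 1)"
proof -
  interpret group PSL2 by (rule group_PSL2)
  let ?U = "chebyshev_mat (pi / real n) 1"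
  let ?A = "vector [vector [1, 1 + 2 * cos (pi / real n)], vector [0, 1]] :: real ^ 2 ^ 2"
  let ?C = "vector [vector [-1, 1], vector [-1, 0]] :: real ^ 2 ^ 2"
  have "?A ** ?U = ?C"
    unfolding chebyshev_mat_1[OF assms]
    by (simp add: matrix_matrix_mult_def vec_eq_iff sum_2 forall_2)
  moreover have "det ?A = 1" by (simp add: det_2)
  ultimately have "elemA n \<otimes>\<^bsub>PSL2\<^esub> proj ?U = elemC"
    by (simp add: elemA_def elemC_def proj_mult det_chebyshev_mat[OF assms] del: One_nat_def)
  moreover have "elemA n \<in> carrier PSL2" "proj ?U \<in> carrier PSL2"
    using assms by (simp_all add: elemA_carrier proj_carrier det_chebyshev_mat)
  ultimately show ?thesis
    using cancel_inv_left(2)[of "elemA n" "proj ?U"] by simp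
qed

lemma order_inv_elemA_mult_elemC:
  assumes "n \<ge> 3"
  shows "(inv\<^bsub>PSL2\<^esub> (elemA n) \<otimes>\<^bsub>PSL2\<^esub> elemC) [^]\<^bsub>PSL2\<^esub> n = \<one>\<^bsub>PSL2\<^esub>"
proof -
  let ?\<theta> = "pi / real n"
  have "sin ?\<theta> > 0"
    using assms by (intro sin_gt_zero) (simp_all add: field_simps)
  then have nz: "sin ?\<theta> \<noteq> 0" by simp
  \<comment> \<open>At \<open>m = n\<close> the three angles are \<open>\<pi> + \<theta>\<close>, \<open>\<pi>\<close> and \<open>\<pi> - \<theta>\<close>.\<close>
  have "chebyshev_mat ?\<theta> n = - mat 1"
    using assms nz
    by (simp add: chebyshev_mat_def mat_def vec_eq_iff forall_2 sin_diff)
  then show ?thesis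
    by (simp add: inv_elemA_mult_elemC[OF nz] proj_chebyshev_pow[OF nz] one_PSL2 proj_eq_iff
        del: One_nat_def)
qed

section \<open>The identity of words\<close>

theorem proposition49:
  fixes n k s :: nat and u :: int and a b :: "nat \<Rightarrow> nat"
  assumes "n \<ge> 3" and "k \<ge> 1" and "s \<ge> 1"
    and "\<forall>i\<in>{1..s}. a i \<ge> 1" and "\<forall>i\<in>{1..<s}. b i \<ge> 1"
  shows "let A = elemA n; C = elemC; W = elemW n;
             U = A [^]\<^bsub>PSL2\<^esub> (-1::int) \<otimes>\<^bsub>PSL2\<^esub> C;
             P = A [^]\<^bsub>PSL2\<^esub> k \<otimes>\<^bsub>PSL2\<^esub> C;
             Q = A [^]\<^bsub>PSL2\<^esub> (k + 1) \<otimes>\<^bsub>PSL2\<^esub> C;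
             X = U [^]\<^bsub>PSL2\<^esub> (n - 3) \<otimes>\<^bsub>PSL2\<^esub> W [^]\<^bsub>PSL2\<^esub> (k - 1)
                   \<otimes>\<^bsub>PSL2\<^esub> A [^]\<^bsub>PSL2\<^esub> (-2::int) \<otimes>\<^bsub>PSL2\<^esub> C;
             Y = U [^]\<^bsub>PSL2\<^esub> (n - 3) \<otimes>\<^bsub>PSL2\<^esub> W [^]\<^bsub>PSL2\<^esub> k
                   \<otimes>\<^bsub>PSL2\<^esub> A [^]\<^bsub>PSL2\<^esub> (-2::int) \<otimes>\<^bsub>PSL2\<^esub> C
         in A [^]\<^bsub>PSL2\<^esub> u \<otimes>\<^bsub>PSL2\<^esub> C
              \<otimes>\<^bsub>PSL2\<^esub> blocks P Q a b (s - 1) \<otimes>\<^bsub>PSL2\<^esub> P [^]\<^bsub>PSL2\<^esub> a 1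
          = A [^]\<^bsub>PSL2\<^esub> (u - 1) \<otimes>\<^bsub>PSL2\<^esub> C \<otimes>\<^bsub>PSL2\<^esub> A [^]\<^bsub>PSL2\<^esub> (-1::int) \<otimes>\<^bsub>PSL2\<^esub> C
              \<otimes>\<^bsub>PSL2\<^esub> blocks X Y a b (s - 1) \<otimes>\<^bsub>PSL2\<^esub> X [^]\<^bsub>PSL2\<^esub> (a 1 - 1)
              \<otimes>\<^bsub>PSL2\<^esub> U [^]\<^bsub>PSL2\<^esub> (n - 3) \<otimes>\<^bsub>PSL2\<^esub> W [^]\<^bsub>PSL2\<^esub> k \<otimes>\<^bsub>PSL2\<^esub> A [^]\<^bsub>PSL2\<^esub> (-1::int)"
proof -
  interpret group PSL2 by (rule group_PSL2)
  define A where "A = elemA n"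
  define C where "C = elemC"
  define W where "W = elemW n"
  define U where "U = inv\<^bsub>PSL2\<^esub> A \<otimes>\<^bsub>PSL2\<^esub> C"
  define V where "V = inv\<^bsub>PSL2\<^esub> A \<otimes>\<^bsub>PSL2\<^esub> inv\<^bsub>PSL2\<^esub> A \<otimes>\<^bsub>PSL2\<^esub> C"
  have A: "A \<in> carrier PSL2" and C: "C \<in> carrier PSL2"
    by (simp_all add: A_def C_def elemA_carrier elemC_carrier)
  have A1: "A [^]\<^bsub>PSL2\<^esub> (-1::int) = inv\<^bsub>PSL2\<^esub> A"
    using A int_pow_neg[of A 1] by simp
  have A2: "A [^]\<^bsub>PSL2\<^esub> (-2::int) = inv\<^bsub>PSL2\<^esub> A \<otimes>\<^bsub>PSL2\<^esub> inv\<^bsub>PSL2\<^esub> A"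
    using A int_pow_mult[of A "-1" "-1"] by (simp add: A1)
  have W: "W = V \<otimes>\<^bsub>PSL2\<^esub> U [^]\<^bsub>PSL2\<^esub> (n - 3) \<otimes>\<^bsub>PSL2\<^esub> V \<otimes>\<^bsub>PSL2\<^esub> U [^]\<^bsub>PSL2\<^esub> (n - 2)"
    by (simp add: W_def elemW_def Let_def U_def V_def A1 A2 flip: A_def C_def)
  have C3: "C \<otimes>\<^bsub>PSL2\<^esub> C \<otimes>\<^bsub>PSL2\<^esub> C = \<one>\<^bsub>PSL2\<^esub>"
    by (simp add: C_def elemC_cubed)
  have Un: "U [^]\<^bsub>PSL2\<^esub> n = \<one>\<^bsub>PSL2\<^esub>"
    using assms(1) by (simp add: U_def A_def C_def order_inv_elemA_mult_elemC)
  interpret triangle: triangle_group PSL2 A C U V W n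
    using A C U_def V_def W C3 Un assms(1) by unfold_locales
  define F where "F j = U [^]\<^bsub>PSL2\<^esub> (n - 3) \<otimes>\<^bsub>PSL2\<^esub> W [^]\<^bsub>PSL2\<^esub> j" for j :: nat
  define g where "g = inv\<^bsub>PSL2\<^esub> C \<otimes>\<^bsub>PSL2\<^esub> U \<otimes>\<^bsub>PSL2\<^esub> U"
  define P where "P = A [^]\<^bsub>PSL2\<^esub> k \<otimes>\<^bsub>PSL2\<^esub> C"
  define Q where "Q = A [^]\<^bsub>PSL2\<^esub> (k + 1) \<otimes>\<^bsub>PSL2\<^esub> C"
  define X where "X = F (k - 1) \<otimes>\<^bsub>PSL2\<^esub> V"
  define Y where "Y = F k \<otimes>\<^bsub>PSL2\<^esub> V"
  have U: "U \<in> carrier PSL2" and V: "V \<in> carrier PSL2"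
    using A C by (simp_all add: U_def V_def)
  then have "W \<in> carrier PSL2" by (simp add: W)
  with U have F: "F j \<in> carrier PSL2" for j by (simp add: F_def)
  have g: "g \<in> carrier PSL2" and P: "P \<in> carrier PSL2" and Q: "Q \<in> carrier PSL2"
    and X: "X \<in> carrier PSL2" and Y: "Y \<in> carrier PSL2"
    using A C U V F by (simp_all add: g_def P_def Q_def X_def Y_def)
  have PX: "P \<otimes>\<^bsub>PSL2\<^esub> g = g \<otimes>\<^bsub>PSL2\<^esub> X"
    using triangle.syllable_intertwine[of "k - 1"] \<open>k \<ge> 1\<close>
    by (simp add: P_def X_def F_def g_def)
  have QY: "Q \<otimes>\<^bsub>PSL2\<^esub> g = g \<otimes>\<^bsub>PSL2\<^esub> Y"
    using triangle.syllable_intertwine[of k] by (simp add: Q_def Y_def F_def g_def)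
  have last: "P = g \<otimes>\<^bsub>PSL2\<^esub> (F k \<otimes>\<^bsub>PSL2\<^esub> inv\<^bsub>PSL2\<^esub> A)"
    using triangle.last_syllable[of k] by (simp add: P_def F_def g_def)
  have first: "A [^]\<^bsub>PSL2\<^esub> u \<otimes>\<^bsub>PSL2\<^esub> C \<otimes>\<^bsub>PSL2\<^esub> g = A [^]\<^bsub>PSL2\<^esub> (u - 1) \<otimes>\<^bsub>PSL2\<^esub> C \<otimes>\<^bsub>PSL2\<^esub> U"
    using triangle.first_syllable[of u] by (simp add: g_def)
  let ?B = "blocks P Q a b (s - 1)" and ?D = "blocks X Y a b (s - 1)"
  have B: "?B \<in> carrier PSL2" and D: "?D \<in> carrier PSL2"
    using P Q X Y by (simp_all add: blocks_closed)
  note closed = A C U V F g P X B D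
  have "a 1 \<ge> 1" using assms(3,4) by simp
  then have Pa: "P [^]\<^bsub>PSL2\<^esub> a 1 = P [^]\<^bsub>PSL2\<^esub> (a 1 - 1) \<otimes>\<^bsub>PSL2\<^esub> P"
    using nat_pow_Suc[of P "a 1 - 1"] by simp
  \<comment> \<open>Only the rightmost of the \<open>a 1\<close> factors is expanded; it supplies the \<open>g\<close> that is then
    moved to the left through everything else.\<close>
  also have "\<dots> = (P [^]\<^bsub>PSL2\<^esub> (a 1 - 1) \<otimes>\<^bsub>PSL2\<^esub> g) \<otimes>\<^bsub>PSL2\<^esub> (F k \<otimes>\<^bsub>PSL2\<^esub> inv\<^bsub>PSL2\<^esub> A)"
    by (subst (2) last) (use closed in \<open>simp add: m_assoc\<close>)
  also have "P [^]\<^bsub>PSL2\<^esub> (a 1 - 1) \<otimes>\<^bsub>PSL2\<^esub> g = g \<otimes>\<^bsub>PSL2\<^esub> X [^]\<^bsub>PSL2\<^esub> (a 1 - 1)"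
    using X P g PX by (rule pow_intertwine)
  finally have "A [^]\<^bsub>PSL2\<^esub> u \<otimes>\<^bsub>PSL2\<^esub> C \<otimes>\<^bsub>PSL2\<^esub> ?B \<otimes>\<^bsub>PSL2\<^esub> P [^]\<^bsub>PSL2\<^esub> a 1
      = A [^]\<^bsub>PSL2\<^esub> u \<otimes>\<^bsub>PSL2\<^esub> C \<otimes>\<^bsub>PSL2\<^esub> (?B \<otimes>\<^bsub>PSL2\<^esub> g)
          \<otimes>\<^bsub>PSL2\<^esub> X [^]\<^bsub>PSL2\<^esub> (a 1 - 1) \<otimes>\<^bsub>PSL2\<^esub> (F k \<otimes>\<^bsub>PSL2\<^esub> inv\<^bsub>PSL2\<^esub> A)"
    using closed by (simp add: m_assoc)
  also have "?B \<otimes>\<^bsub>PSL2\<^esub> g = g \<otimes>\<^bsub>PSL2\<^esub> ?D"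
    using P Q X Y g PX QY by (rule blocks_intertwine)
  also have "A [^]\<^bsub>PSL2\<^esub> u \<otimes>\<^bsub>PSL2\<^esub> C \<otimes>\<^bsub>PSL2\<^esub> (g \<otimes>\<^bsub>PSL2\<^esub> ?D)
      = A [^]\<^bsub>PSL2\<^esub> (u - 1) \<otimes>\<^bsub>PSL2\<^esub> C \<otimes>\<^bsub>PSL2\<^esub> U \<otimes>\<^bsub>PSL2\<^esub> ?D"
    using closed by (simp flip: first add: m_assoc)
  finally have main: "A [^]\<^bsub>PSL2\<^esub> u \<otimes>\<^bsub>PSL2\<^esub> C \<otimes>\<^bsub>PSL2\<^esub> ?B \<otimes>\<^bsub>PSL2\<^esub> P [^]\<^bsub>PSL2\<^esub> a 1
      = A [^]\<^bsub>PSL2\<^esub> (u - 1) \<otimes>\<^bsub>PSL2\<^esub> C \<otimes>\<^bsub>PSL2\<^esub> U \<otimes>\<^bsub>PSL2\<^esub> ?D \<otimes>\<^bsub>PSL2\<^esub> X [^]\<^bsub>PSL2\<^esub> (a 1 - 1)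
          \<otimes>\<^bsub>PSL2\<^esub> (F k \<otimes>\<^bsub>PSL2\<^esub> inv\<^bsub>PSL2\<^esub> A)" .
  have X': "X = U [^]\<^bsub>PSL2\<^esub> (n - 3) \<otimes>\<^bsub>PSL2\<^esub> W [^]\<^bsub>PSL2\<^esub> (k - 1)
                   \<otimes>\<^bsub>PSL2\<^esub> A [^]\<^bsub>PSL2\<^esub> (-2::int) \<otimes>\<^bsub>PSL2\<^esub> C"
    and Y': "Y = U [^]\<^bsub>PSL2\<^esub> (n - 3) \<otimes>\<^bsub>PSL2\<^esub> W [^]\<^bsub>PSL2\<^esub> k
                   \<otimes>\<^bsub>PSL2\<^esub> A [^]\<^bsub>PSL2\<^esub> (-2::int) \<otimes>\<^bsub>PSL2\<^esub> C"
    using A C F[unfolded F_def] by (simp_all add: X_def Y_def F_def V_def A2 m_assoc)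
  have U': "U = A [^]\<^bsub>PSL2\<^esub> (-1::int) \<otimes>\<^bsub>PSL2\<^esub> C"
    by (simp add: U_def A1)
  show ?thesis
    unfolding Let_def A_def[symmetric] C_def[symmetric] W_def[symmetric] U'[symmetric]
      P_def[symmetric] Q_def[symmetric] X'[symmetric] Y'[symmetric] main
    using closed \<open>W \<in> carrier PSL2\<close> by (simp add: m_assoc F_def A1 U_def)
qed

end
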